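(* For $n\ge1$ let $S_n(132)$ be the set of $132$-avoiding permutations of $\{1,\dots,n\}$. Let $a_0=1$, and for $n\ge1$ let $a_n$ be the number of $\sigma=\sigma_1\cdots\sigma_n\in S_n(132)$ such that every index $i\in\{1,\dots,n\}$ satisfies $|\sigma_i-\sigma_{i+1}|=1$ or $|\sigma_{i-1}-\sigma_i|=1$ (ignoring nonexistent entries), and let $b_n$ be the number of such $\sigma$ that additionally satisfy $\sigma_1=n$. Let $A(t)=\sum_{n\ge0}a_nt^n$ and $B(t)=\sum_{n\ge1}b_nt^n$. Then $$A(t)=\frac{1-t+2t^3-\sqrt{1-2t-3t^2+4t^3-4t^4}}{2t^2},\qquad B(t)=\frac{1+t-2t^2+2t^3-\sqrt{1-2t-3t^2+4t^3-4t^4}}{2(1-t+t^2)}.$$ In particular, $(a_n)_{n\ge0}$ begins $1,1,2,2,6,10,26,54,134,306,754,\dots$ and $(b_n)_{n\ge0}$ (with $b_0=0$) begins $0,1,1,1,2,3,7,14,33,73,174,\dots$.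
   Context: A permutation $\sigma\in S_n$ avoids $132$ if there are no indices $i<j<k$ with $\sigma_i<\sigma_k<\sigma_j$. The square root is the branch with constant term $1$ as a formal power series in $t$. *)

theory Defs
  imports
    "HOL-Combinatorics.Permutations"
    "HOL-Computational_Algebra.Formal_Laurent_Series"
begin

text \<open>Permutations of \<open>{1..n}\<close> are functions \<open>\<sigma>\<close> with \<open>\<sigma> permutes {1..n}\<close>;
  \<open>\<sigma> i\<close> is the entry in position \<open>i\<close> of the one-line notation.\<close>

definition avoids_132 :: "nat \<Rightarrow> (nat \<Rightarrow> nat) \<Rightarrow> bool" where
  "avoids_132 n \<sigma> \<longleftrightarrow>
     \<not> (\<exists>i j k. 1 \<le> i \<and> i < j \<and> j < k \<and> k \<le> n \<and> \<sigma> i < \<sigma> k \<and> \<sigma> k < \<sigma> j)"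

definition S132 :: "nat \<Rightarrow> (nat \<Rightarrow> nat) set" where
  "S132 n = {\<sigma>. \<sigma> permutes {1..n} \<and> avoids_132 n \<sigma>}"

text \<open>The guards \<open>i < n\<close> and \<open>1 < i\<close> drop the comparisons with nonexistent entries.
  For \<open>n = 1\<close> both comparisons are dropped, nothing is left to check, and the only
  permutation is accepted; this convention is what makes the counts for \<open>n = 1\<close> equal
  to \<open>1\<close>.\<close>

definition every_entry_has_close_neighbour :: "nat \<Rightarrow> (nat \<Rightarrow> nat) \<Rightarrow> bool" where
  "every_entry_has_close_neighbour n \<sigma> \<longleftrightarrow>
     n = 1 \<or>
     (\<forall>i\<in>{1..n}. (i < n \<and> \<bar>int (\<sigma> i) - int (\<sigma> (i + 1))\<bar> = 1) \<or>
                 (1 < i \<and> \<bar>int (\<sigma> (i - 1)) - int (\<sigma> i)\<bar> = 1))"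

definition a_seq :: "nat \<Rightarrow> nat" where
  "a_seq n = (if n = 0 then 1
              else card {\<sigma> \<in> S132 n. every_entry_has_close_neighbour n \<sigma>})"

definition b_seq :: "nat \<Rightarrow> nat" where
  "b_seq n = (if n = 0 then 0
              else card {\<sigma> \<in> S132 n. every_entry_has_close_neighbour n \<sigma> \<and> \<sigma> 1 = n})"

definition A_gf :: "real fps" where
  "A_gf = Abs_fps (\<lambda>n. of_nat (a_seq n))"

definition B_gf :: "real fps" where
  "B_gf = Abs_fps (\<lambda>n. of_nat (b_seq n))"

text \<open>\<open>fps_radical root 2\<close> takes the square root whose constant term is the real number
  \<open>root 2\<close> of the constant term of the argument. For constant term \<open>1\<close> this is the unique
  square root with constant term \<open>1\<close>, as the lemmas below confirm.\<close>

definition fps_sqrt :: "real fps \<Rightarrow> real fps" where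
  "fps_sqrt f = fps_radical root 2 f"

definition discr :: "real fps" where
  "discr = 1 - 2 * fps_X - 3 * fps_X ^ 2 + 4 * fps_X ^ 3 - 4 * fps_X ^ 4"

lemma fps_sqrt_square:
  assumes "fps_nth f 0 = 1"
  shows "fps_sqrt f ^ 2 = f"
  using power_radical[of f root 1] assms
  by (simp add: fps_sqrt_def numeral_2_eq_2)

lemma fps_sqrt_nth_0:
  assumes "fps_nth f 0 = 1"
  shows "fps_nth (fps_sqrt f) 0 = 1"
  using assms by (simp add: fps_sqrt_def numeral_2_eq_2)

lemma fps_sqrt_unique:
  assumes "g ^ 2 = f" "fps_nth g 0 = 1"
  shows "g = fps_sqrt f"
proof -
  have f0: "fps_nth f 0 = 1"
    using assms by (auto simp: power2_eq_square)
  have "(g - fps_sqrt f) * (g + fps_sqrt f) = 0"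
    using assms(1) fps_sqrt_square[OF f0] by (simp add: algebra_simps power2_eq_square)
  moreover have "fps_nth (g + fps_sqrt f) 0 \<noteq> 0"
    using assms(2) fps_sqrt_nth_0[OF f0] by simp
  then have "g + fps_sqrt f \<noteq> 0"
    by (metis fps_zero_nth)
  ultimately show ?thesis by simp
qed

lemma discr_nth_0: "fps_nth discr 0 = 1"
  by (simp add: discr_def)

text \<open>The closed forms for \<open>A_gf\<close> and \<open>B_gf\<close> are to be read in the field of formal
  Laurent series (via \<open>fps_to_fls\<close>): division of power series by a non-unit such as
  \<open>2 * fps_X ^ 2\<close> silently discards low-order terms of the numerator.\<close>

end

theory Submission
  imports Defs
begin

text \<open>Cut a \<open>132\<close>-avoiding permutation with close neighbours as \<open>L n R\<close>: all entries of \<open>L\<close>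
  exceed those of \<open>R\<close>, so if \<open>L\<close> is nonempty then \<open>n\<close> and the first entry of \<open>R\<close> are not close,
  and \<open>L n\<close> and \<open>R\<close> can be chosen independently. A permutation starting with \<open>n\<close> must start with
  \<open>n, n - 1\<close>; removing \<open>n\<close>, or \<open>n\<close> and \<open>n - 1\<close>, gives a linear recursion, and the same one holds
  for permutations ending with \<open>n\<close>. If \<open>A'\<close> and \<open>B'\<close> differ from \<open>A\<close> and \<open>B\<close> only in not counting
  the permutation of length \<open>1\<close>, this says \<open>A' = 1 + B' + B' A'\<close> and
  \<open>(1 - t + t\<^sup>2) B' = t\<^sup>2 A'\<close>, which makes \<open>1 - t - 2 t\<^sup>2 A'\<close> the square root in question.\<close>

section \<open>Permutations as lists\<close>

definition close :: "nat \<Rightarrow> nat \<Rightarrow> bool" where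
  "close x y \<longleftrightarrow> x = Suc y \<or> y = Suc x"

lemma close_commute: "close x y \<longleftrightarrow> close y x"
  by (auto simp: close_def)

lemma close_add [simp]: "close (x + r) (y + r) \<longleftrightarrow> close x y"
  by (auto simp: close_def)

lemma close_iff_abs: "close x y \<longleftrightarrow> \<bar>int x - int y\<bar> = 1"
  by (auto simp: close_def)

text \<open>The flag tells whether the first entry needs no close neighbour.\<close>

fun ok :: "bool \<Rightarrow> nat list \<Rightarrow> bool" where
  "ok e [] = True"
| "ok e [x] = e"
| "ok e (x # y # zs) = (if close x y then ok True (y # zs) else e \<and> ok False (y # zs))"

text \<open>Puts the left-to-right scan into a form that shows both neighbours, as reversal and the
  comparison with permutations as functions need.\<close>

lemma ok_nth:
  "ok e xs \<longleftrightarrow> (\<forall>i<length xs. i = 0 \<and> e \<or> Suc i < length xs \<and> close (xs ! i) (xs ! Suc i)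
     \<or> 0 < i \<and> close (xs ! (i - 1)) (xs ! i))"
proof (induction e xs rule: ok.induct)
  case (3 e x y zs)
  then show ?case
    by (cases "close x y") (auto simp: All_less_Suc2 simp del: One_nat_def)
qed (auto simp: All_less_Suc2)

text \<open>Nothing is helped across the junction, so \<open>ys\<close> starts afresh with flag
  \<open>False\<close>; were \<open>xs\<close> empty, \<open>ys\<close> would inherit
  \<open>e\<close> instead.\<close>

lemma ok_append:
  assumes "ys \<noteq> [] \<Longrightarrow> \<not> close (last xs) (hd ys)" "xs \<noteq> []"
  shows "ok e (xs @ ys) \<longleftrightarrow> ok e xs \<and> ok False ys"
  using assms
proof (induction e xs rule: ok.induct)
  case (2 e x)
  then show ?case by (cases ys) auto
qed auto

lemma ok_map_add [simp]: "ok e (map (\<lambda>x. x + r) xs) \<longleftrightarrow> ok e xs"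
  by (induction e xs rule: ok.induct) auto

lemma ok_rev: "ok False (rev xs) \<longleftrightarrow> ok False xs"
proof -
  have "ok False (rev xs)" if "ok False xs" for xs
    unfolding ok_nth
  proof (intro allI impI)
    fix i assume i: "i < length (rev xs)"
    \<comment> \<open>Reversal exchanges positions \<open>i\<close> and \<open>j\<close>, and with
      them left and right neighbours.\<close>
    define j where "j = length xs - Suc i"
    have j: "j < length xs" using i by (simp add: j_def)
    have "Suc j < length xs \<and> close (xs ! j) (xs ! Suc j) \<or> 0 < j \<and> close (xs ! (j - 1)) (xs ! j)"
      using that j by (auto simp: ok_nth)
    then show "i = 0 \<and> False \<or> Suc i < length (rev xs) \<and> close (rev xs ! i) (rev xs ! Suc i) \<or>
         0 < i \<and> close (rev xs ! (i - 1)) (rev xs ! i)"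
    proof (elim disjE conjE)
      assume "Suc j < length xs" "close (xs ! j) (xs ! Suc j)"
      moreover from this have "0 < i" "length xs - Suc (i - 1) = Suc j" using i by (auto simp: j_def)
      ultimately show ?thesis using i by (auto simp: rev_nth j_def[symmetric] close_commute)
    next
      assume "0 < j" "close (xs ! (j - 1)) (xs ! j)"
      moreover from this have "Suc i < length xs" "length xs - Suc (Suc i) = j - 1"
        using i by (auto simp: j_def)
      ultimately show ?thesis using i by (auto simp: rev_nth j_def[symmetric] close_commute)
    qed
  qed
  from this[of xs] this[of "rev xs"] show ?thesis by auto
qed

section \<open>Avoidance of 132 on lists\<close>

fun no_21_above :: "nat \<Rightarrow> nat list \<Rightarrow> bool" where
  "no_21_above x [] = True"
| "no_21_above x (y # ys) \<longleftrightarrow> no_21_above x ys \<and> (\<forall>z\<in>set ys. \<not> (x < z \<and> z < y))"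

text \<open>Each entry is tested as the 1 of a pattern; its 3 and 2 would be a descending pair above
  it in the tail.\<close>

fun av :: "nat list \<Rightarrow> bool" where
  "av [] = True"
| "av (x # xs) \<longleftrightarrow> av xs \<and> no_21_above x xs"

lemma no_21_above_nth:
  "no_21_above x ys \<longleftrightarrow> (\<forall>k<length ys. \<forall>j<k. \<not> (x < ys ! k \<and> ys ! k < ys ! j))"
proof (induction ys)
  case (Cons y ys)
  then show ?case
    by (simp add: All_less_Suc2 all_set_conv_all_nth) blast
qed simp

lemma av_nth:
  "av xs \<longleftrightarrow> (\<forall>k<length xs. \<forall>j<k. \<forall>i<j. \<not> (xs ! i < xs ! k \<and> xs ! k < xs ! j))"
proof (induction xs)
  case (Cons x xs)
  then show ?case
    by (simp add: All_less_Suc2 no_21_above_nth) blast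
qed simp

lemma no_21_above_append:
  "no_21_above x (xs @ ys) \<longleftrightarrow> no_21_above x xs \<and> no_21_above x ys \<and>
     (\<forall>y\<in>set xs. \<forall>z\<in>set ys. \<not> (x < z \<and> z < y))"
  by (induction xs) auto

lemma no_21_above_trivial: "\<forall>y\<in>set ys. y \<le> x \<Longrightarrow> no_21_above x ys"
  by (induction ys) auto

lemma no_21_above_map_add [simp]:
  "no_21_above (x + r) (map (\<lambda>x. x + r) ys) \<longleftrightarrow> no_21_above x ys"
  by (induction ys) auto

lemma av_map_add [simp]: "av (map (\<lambda>x. x + r) xs) \<longleftrightarrow> av xs"
  by (induction xs) auto

text \<open>A pattern not inside \<open>L\<close> or \<open>R\<close> has its 1 in \<open>L\<close>
  and its 2 in \<open>R\<close>, since \<open>m\<close> is too large for either role. Conversely,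
  any \<open>x < y\<close> with \<open>x\<close> in \<open>L\<close> and \<open>y\<close> in
  \<open>R\<close> forms a pattern with \<open>m\<close> as the 3.\<close>

lemma av_split_at_max:
  assumes "\<forall>x\<in>set L \<union> set R. x < m"
  shows "av (L @ m # R) \<longleftrightarrow> av L \<and> av R \<and> (\<forall>x\<in>set L. \<forall>y\<in>set R. y \<le> x)"
  using assms
proof (induction L)
  case Nil
  then show ?case by (simp add: no_21_above_trivial less_imp_le)
next
  case (Cons x L)
  have "no_21_above x (L @ m # R) \<longleftrightarrow> no_21_above x L \<and> (\<forall>y\<in>set R. y \<le> x)"
  proof (cases "\<forall>y\<in>set R. y \<le> x")
    case True
    then show ?thesis
      using Cons.prems by (simp add: no_21_above_append no_21_above_trivial) (meson UnI1 leD less_asym)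
  next
    case False
    then obtain y where "y \<in> set R" "x < y" "y < m"
      using Cons.prems by (auto simp: not_le)
    then have "\<not> no_21_above x (m # R)" by auto
    then show ?thesis using False by (simp only: no_21_above_append) blast
  qed
  moreover have "av (L @ m # R) \<longleftrightarrow> av L \<and> av R \<and> (\<forall>x\<in>set L. \<forall>y\<in>set R. y \<le> x)"
    using Cons by simp
  ultimately show ?case by (simp only: av.simps append_Cons list.set ball_simps) blast
qed

section \<open>Recursions\<close>

text \<open>\<open>Q\<close> is kept abstract so that the recursion for leading maxima also applies
  to avoidance by the reversed list. The flag \<open>False\<close> rejects one-entry lists, so
  \<open>n = 1\<close> gives the empty set, unlike in \<open>a_seq\<close>.\<close>

definition perm_lists :: "(nat list \<Rightarrow> bool) \<Rightarrow> nat \<Rightarrow> nat list set" where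
  "perm_lists Q n = {xs. distinct xs \<and> set xs = {1..n} \<and> Q xs \<and> ok False xs}"

definition max_first :: "(nat list \<Rightarrow> bool) \<Rightarrow> nat \<Rightarrow> nat list set" where
  "max_first Q n = {xs \<in> perm_lists Q n. xs \<noteq> [] \<and> hd xs = n}"

definition max_last :: "(nat list \<Rightarrow> bool) \<Rightarrow> nat \<Rightarrow> nat list set" where
  "max_last Q n = {xs \<in> perm_lists Q n. xs \<noteq> [] \<and> last xs = n}"

lemma length_perm_lists: "xs \<in> perm_lists Q n \<Longrightarrow> length xs = n"
  using distinct_card[of xs] by (simp add: perm_lists_def)

lemma finite_perm_lists [simp]: "finite (perm_lists Q n)"
proof (rule finite_subset)
  show "perm_lists Q n \<subseteq> {xs. set xs \<subseteq> {1..n} \<and> length xs = n}"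
    using length_perm_lists by (fastforce simp: perm_lists_def)
qed (simp add: finite_lists_length_eq)

lemma finite_max_first [simp]: "finite (max_first Q n)"
  by (simp add: max_first_def)

lemma perm_lists_0 [simp]: "Q [] \<Longrightarrow> perm_lists Q 0 = {[]}"
  by (auto simp: perm_lists_def)

lemma perm_lists_1 [simp]: "perm_lists Q (Suc 0) = {}"
proof -
  have False if xs: "xs \<in> perm_lists Q (Suc 0)" for xs
  proof -
    obtain x where "xs = [x]"
      using length_perm_lists[OF xs] by (metis length_0_conv length_Suc_conv)
    then show False using xs by (simp add: perm_lists_def)
  qed
  then show ?thesis by blast
qed

lemma max_first_0 [simp]: "max_first Q 0 = {}"
  by (auto simp: max_first_def perm_lists_def)

lemma max_first_1 [simp]: "max_first Q (Suc 0) = {}"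
  by (simp add: max_first_def)

lemma max_last_0 [simp]: "max_last Q 0 = {}"
  by (auto simp: max_last_def perm_lists_def)

lemma max_last_1 [simp]: "max_last Q (Suc 0) = {}"
  by (simp add: max_last_def)

section \<open>Removing a leading maximum\<close>

lemma distinct_set_Cons_Suc:
  "distinct (Suc n # xs) \<and> set (Suc n # xs) = {1..Suc n} \<longleftrightarrow> distinct xs \<and> set xs = {1..n}"
proof -
  have "Suc n \<notin> set xs \<Longrightarrow> insert (Suc n) (set xs) = insert (Suc n) {1..n} \<longleftrightarrow> set xs = {1..n}"
    by (rule insert_ident) simp_all
  then show ?thesis by (auto simp: atLeastAtMostSuc_conv)
qed

text \<open>Only \<open>Suc n\<close> is close to a leading \<open>Suc (Suc n)\<close>, so it comes
  second. If \<open>n\<close> follows, the list stays valid without its maximum; otherwise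
  \<open>Suc n\<close> is not close to what follows, and the rest must be valid on its own.\<close>

lemma max_first_Suc_Suc:
  assumes Q: "\<And>m xs. \<forall>x\<in>set xs. x < m \<Longrightarrow> Q (m # xs) = Q xs"
  shows "max_first Q (Suc (Suc n)) = (#) (Suc (Suc n)) ` max_first Q (Suc n) \<union>
    (\<lambda>zs. Suc (Suc n) # Suc n # zs) ` (perm_lists Q n - max_first Q n)"
    (is "_ = ?U \<union> ?V")
proof (rule set_eqI)
  have QS: "Q (Suc n # zs) = Q zs" "Q (Suc (Suc n) # Suc n # zs) = Q zs" if "set zs = {1..n}" for zs
    using that Q[of zs "Suc n"] Q[of "Suc n # zs" "Suc (Suc n)"] by (auto simp: less_Suc_eq_le)
  have not_close: "\<not> close (Suc n) (hd zs)" if "set zs = {1..n}" "zs \<noteq> []" "hd zs \<noteq> n" for zs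
    using that hd_in_set[of zs] by (auto simp: close_def)
  fix xs
  \<comment> \<open>The flag \<open>True\<close> records that \<open>Suc n\<close> already has its
    close neighbour in front.\<close>
  have "xs \<in> max_first Q (Suc (Suc n)) \<longleftrightarrow>
     (\<exists>zs. xs = Suc (Suc n) # Suc n # zs \<and> distinct zs \<and> set zs = {1..n} \<and> Q zs
        \<and> ok True (Suc n # zs))" (is "_ \<longleftrightarrow> ?E")
  proof
    assume "xs \<in> max_first Q (Suc (Suc n))"
    then obtain ys where xs: "xs = Suc (Suc n) # ys"
      and ys: "distinct xs" "set xs = {1..Suc (Suc n)}" "Q xs" "ok False xs"
      by (cases xs) (auto simp: max_first_def perm_lists_def)
    have ys': "distinct ys" "set ys = {1..Suc n}"
      using ys distinct_set_Cons_Suc[of "Suc n" ys] by (auto simp: xs)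
    obtain y zs where y: "ys = y # zs" using ys'(2) by (cases ys) auto
    have "close (Suc (Suc n)) y" using ys(4) by (auto simp: xs y split: if_splits)
    moreover have "y \<in> {1..Suc n}" using ys' y by auto
    ultimately have "y = Suc n" by (auto simp: close_def)
    then show ?E
      using xs y ys ys' distinct_set_Cons_Suc[of "n" zs] QS by (auto split: if_splits)
  next
    assume ?E
    then obtain zs where zs: "xs = Suc (Suc n) # Suc n # zs" "distinct zs" "set zs = {1..n}"
       "Q zs" "ok True (Suc n # zs)" by blast
    then show "xs \<in> max_first Q (Suc (Suc n))"
      using QS by (auto simp: max_first_def perm_lists_def close_def)
  qed
  also have "\<dots> \<longleftrightarrow> xs \<in> ?U \<union> ?V"
  proof
    assume ?E
    then obtain zs where zs: "xs = Suc (Suc n) # Suc n # zs" "distinct zs" "set zs = {1..n}"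
       "Q zs" "ok True (Suc n # zs)" by blast
    show "xs \<in> ?U \<union> ?V"
    proof (cases "zs \<noteq> [] \<and> hd zs = n")
      case True
      then have "Suc n # zs \<in> max_first Q (Suc n)"
        using zs QS by (cases zs) (auto simp: max_first_def perm_lists_def close_def)
      then show ?thesis using zs by auto
    next
      case False
      then have "ok False zs"
        using zs not_close[of zs] by (cases zs) auto
      then show ?thesis using False zs by (auto simp: max_first_def perm_lists_def)
    qed
  next
    assume "xs \<in> ?U \<union> ?V"
    then show ?E
    proof
      assume "xs \<in> ?U"
      then obtain zs where zs: "xs = Suc (Suc n) # Suc n # zs" "Suc n # zs \<in> perm_lists Q (Suc n)"
        by (auto simp: max_first_def) (metis list.collapse)
      have "ok True (Suc n # zs)"
        using zs(2) by (cases zs) (auto simp: perm_lists_def split: if_splits)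
      moreover have "distinct zs \<and> set zs = {1..n}"
        using zs distinct_set_Cons_Suc[of n zs] by (auto simp: perm_lists_def)
      ultimately show ?E using zs QS by (auto simp: perm_lists_def)
    next
      assume "xs \<in> ?V"
      then obtain zs where zs: "xs = Suc (Suc n) # Suc n # zs" "zs \<in> perm_lists Q n"
        "\<not> (zs \<noteq> [] \<and> hd zs = n)" by (auto simp: max_first_def)
      then have "ok True (Suc n # zs)"
        using not_close[of zs] by (cases zs) (auto simp: perm_lists_def)
      then show ?E using zs by (auto simp: perm_lists_def)
    qed
  qed
  finally show "xs \<in> max_first Q (Suc (Suc n)) \<longleftrightarrow> xs \<in> ?U \<union> ?V" .
qed

lemma card_max_first_Suc_Suc:
  assumes Q: "\<And>m xs. \<forall>x\<in>set xs. x < m \<Longrightarrow> Q (m # xs) = Q xs"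
  shows "card (max_first Q (Suc (Suc n))) + card (max_first Q n) =
    card (max_first Q (Suc n)) + card (perm_lists Q n)"
proof -
  have sub: "max_first Q n \<subseteq> perm_lists Q n" by (auto simp: max_first_def)
  have eq: "max_first Q (Suc (Suc n)) = (#) (Suc (Suc n)) ` max_first Q (Suc n) \<union>
      (\<lambda>zs. Suc (Suc n) # Suc n # zs) ` (perm_lists Q n - max_first Q n)"
    by (rule max_first_Suc_Suc[OF Q])
  \<comment> \<open>The two images are disjoint: a leading \<open>Suc n\<close> not followed by
    \<open>n\<close> has no close neighbour.\<close>
  have "Suc n # zs \<notin> max_first Q (Suc n)" if "zs \<in> perm_lists Q n - max_first Q n" for zs
  proof (cases zs)
    case (Cons y ys)
    then have "y \<noteq> n" "y \<in> {1..n}" using that by (auto simp: max_first_def perm_lists_def)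
    then show ?thesis using Cons by (auto simp: max_first_def perm_lists_def close_def)
  qed (auto simp: max_first_def perm_lists_def)
  then have "card (max_first Q (Suc (Suc n))) =
      card ((#) (Suc (Suc n)) ` max_first Q (Suc n)) +
      card ((\<lambda>zs. Suc (Suc n) # Suc n # zs) ` (perm_lists Q n - max_first Q n))"
    unfolding eq by (intro card_Un_disjoint) auto
  also have "\<dots> = card (max_first Q (Suc n)) + (card (perm_lists Q n) - card (max_first Q n))"
    using sub by (simp add: card_image inj_on_def card_Diff_subset)
  finally show ?thesis
    using card_mono[OF _ sub] by simp
qed

section \<open>Reversal\<close>

lemma image_rev_Collect: "rev ` {xs. P xs} = {xs. P (rev xs)}"
proof (intro set_eqI iffI)
  fix xs assume "xs \<in> {xs. P (rev xs)}"
  then show "xs \<in> rev ` {xs. P xs}" by (intro image_eqI[of _ _ "rev xs"]) auto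
qed auto

lemma rev_perm_lists: "rev ` perm_lists Q n = perm_lists (\<lambda>xs. Q (rev xs)) n"
  by (simp add: perm_lists_def image_rev_Collect ok_rev)

lemma rev_max_first: "rev ` max_first (\<lambda>xs. Q (rev xs)) n = max_last Q n"
  by (auto simp: max_first_def max_last_def perm_lists_def image_rev_Collect ok_rev hd_rev)

text \<open>Reversal turns a trailing maximum into a leading one and \<open>Q\<close> into
  \<open>?R\<close>. The recursion for leading maxima holds for both predicates, with equal
  inhomogeneous terms \<open>G\<close> and equal initial values, so the counts agree although no
  direct bijection is given.\<close>

lemma card_max_last:
  assumes "\<And>m xs. \<forall>x\<in>set xs. x < m \<Longrightarrow> Q (m # xs) = Q xs"
    and "\<And>m xs. \<forall>x\<in>set xs. x < m \<Longrightarrow> Q (xs @ [m]) = Q xs"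
  shows "card (max_last Q n) = card (max_first Q n)"
proof -
  let ?R = "\<lambda>xs. Q (rev xs)"
  have G: "card (perm_lists ?R n) = card (perm_lists Q n)" for n
    unfolding rev_perm_lists[symmetric] by (simp add: card_image)
  \<comment> \<open>The recursion has order two, so two consecutive values are carried along; both
    start at 0.\<close>
  have "card (max_first ?R n) = card (max_first Q n) \<and>
    card (max_first ?R (Suc n)) = card (max_first Q (Suc n))"
  proof (induction n)
    case (Suc n)
    moreover have "card (max_first ?R (Suc (Suc n))) + card (max_first ?R n) =
      card (max_first ?R (Suc n)) + card (perm_lists ?R n)"
      by (rule card_max_first_Suc_Suc) (simp add: assms(2))
    ultimately show ?case
      using card_max_first_Suc_Suc[of Q n, OF assms(1)] G[of n] by simp
  qed simp
  then show ?thesis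
    unfolding rev_max_first[symmetric] by (simp add: card_image)
qed

section \<open>Cutting a list after its maximum\<close>

lemma av_Cons_max: "\<forall>x\<in>set xs. x < m \<Longrightarrow> av (m # xs) = av xs"
  using av_split_at_max[of "[]" xs m] by simp

lemma av_snoc_max: "\<forall>x\<in>set xs. x < m \<Longrightarrow> av (xs @ [m]) = av xs"
  using av_split_at_max[of xs "[]" m] by simp

lemma card_max_first_rec:
  "card (max_first av (Suc (Suc n))) + card (max_first av n) =
    card (max_first av (Suc n)) + card (perm_lists av n)"
  by (rule card_max_first_Suc_Suc[OF av_Cons_max])

text \<open>Undoes the cut: \<open>xs\<close> is the block ending in the maximum, standardized to
  \<open>{1..k}\<close>, and the shift lifts it above \<open>ys\<close>.\<close>

definition glue :: "nat \<Rightarrow> nat \<times> nat list \<times> nat list \<Rightarrow> nat list" where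
  "glue n = (\<lambda>(k, xs, ys). map (\<lambda>x. x + (n - k)) xs @ ys)"

text \<open>A one-entry list has no close neighbours, hence \<open>2 \<le> k\<close> and something
  precedes the maximum.\<close>

lemma max_lastE:
  assumes "xs \<in> max_last Q k"
  obtains M where "xs = M @ [k]" "M \<noteq> []" "distinct M" "set M = {1..<k}" "2 \<le> k"
proof -
  have k: "k \<noteq> 0" "k \<noteq> Suc 0" using assms by (intro notI; simp)+
  obtain M where M: "xs = M @ [k]"
    using assms by (auto simp: max_last_def) (metis append_butlast_last_id)
  have "distinct M" "k \<notin> set M" "insert k (set M) = {1..k}"
    using assms by (auto simp: M max_last_def perm_lists_def)
  moreover from this have "set M = {1..<k}" by (auto simp: less_le)
  moreover from this have "M \<noteq> []" using k by auto
  ultimately show ?thesis using M k that by auto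
qed

lemma glue_in:
  assumes "k \<le> n" "xs \<in> max_last av k" "ys \<in> perm_lists av (n - k)"
  shows "glue n (k, xs, ys) \<in> perm_lists av n - max_first av n"
proof -
  define r where "r = n - k"
  have n: "n = k + r" using assms by (simp add: r_def)
  obtain M where M: "xs = M @ [k]" "M \<noteq> []" "distinct M" "set M = {1..<k}" "2 \<le> k"
    using max_lastE[OF assms(2)] .
  let ?f = "\<lambda>x. x + r"
  have xs: "distinct xs" "set xs = {1..k}" "av xs" "ok False xs"
    using assms(2) by (auto simp: max_last_def perm_lists_def)
  have ys: "distinct ys" "set ys = {1..r}" "av ys" "ok False ys"
    using assms(3) by (auto simp: perm_lists_def r_def)
  have "xs \<noteq> []" using M by simp
  have g: "glue n (k, xs, ys) = map ?f xs @ ys" by (simp add: glue_def r_def)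
  have "?f ` {1..k} = {r + 1..n}" by (simp add: n image_add_atLeastAtMost' add.commute)
  then have set: "set (map ?f xs) = {r + 1..n}" using xs by simp
  have "av (map ?f M @ n # ys)"
    using xs ys av_snoc_max[of M k] M
    by (subst av_split_at_max) (auto simp: n)
  then have "av (map ?f xs @ ys)" by (simp add: M n)
  moreover have "ok False (map ?f xs @ ys)"
  proof (subst ok_append)
    assume "ys \<noteq> []"
    \<comment> \<open>The block ends in \<open>k + r\<close> with \<open>2 \<le> k\<close>, which is
      at distance at least 2 from any value up to \<open>r\<close>.\<close>
    then have "hd ys \<le> r" using ys hd_in_set[of ys] by auto
    then show "\<not> close (last (map ?f xs)) (hd ys)" using M by (auto simp: close_def last_map)
  qed (use xs ys \<open>xs \<noteq> []\<close> in auto)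
  moreover have "distinct (map ?f xs @ ys)"
    using xs ys set by (auto simp: distinct_map inj_on_def)
  moreover have "set (map ?f xs @ ys) = {1..n}"
    using ys(2) set n by auto
  \<comment> \<open>The head comes from the nonempty \<open>M\<close>, whose entries are below
    \<open>k\<close>.\<close>
  moreover have "hd (map ?f xs @ ys) \<noteq> n"
    using M hd_in_set[of M] by (auto simp: n hd_map)
  ultimately show ?thesis unfolding g by (auto simp: max_first_def perm_lists_def)
qed

lemma down_closed_eq_atLeastAtMost:
  assumes "finite S" "0 \<notin> S" "\<And>x y. x \<in> S \<Longrightarrow> 1 \<le> y \<Longrightarrow> y \<le> x \<Longrightarrow> y \<in> S"
  shows "S = {1..card S}"
proof (cases "S = {}")
  case False
  have "S = {1..Max S}"
    using assms Max_in[OF assms(1) False] Max_ge[OF assms(1)]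
    by (auto simp: Suc_le_eq intro!: gr0I)
  then show ?thesis by (metis card_atLeastAtMost diff_Suc_1)
qed simp

text \<open>As \<open>zs\<close> does not start with \<open>n\<close>, the part \<open>L\<close>
  before \<open>n\<close> is nonempty. Avoidance puts \<open>L\<close> above the part
  \<open>R\<close> after \<open>n\<close>, so \<open>R\<close> takes the values
  \<open>{1..r}\<close>, and lowering \<open>L @ [n]\<close> by \<open>r\<close> gives the other
  component.\<close>

lemma in_glue_image:
  assumes "0 < n" "zs \<in> perm_lists av n - max_first av n"
  shows "zs \<in> glue n ` (SIGMA k:{..n}. max_last av k \<times> perm_lists av (n - k))"
proof -
  have zs: "distinct zs" "set zs = {1..n}" "av zs" "ok False zs" "zs \<noteq> []" "hd zs \<noteq> n"
    using assms by (auto simp: max_first_def perm_lists_def)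
  obtain L R where LR: "zs = L @ n # R"
    using zs(2) assms(1) split_list[of n zs] by auto
  have L: "L \<noteq> []" using zs LR by auto
  have un: "set L \<union> set R = {1..<n}"
  proof -
    have "n \<notin> set L \<union> set R" "insert n (set L \<union> set R) = {1..n}"
      using zs by (auto simp: LR)
    then show ?thesis by (auto simp: less_le)
  qed
  have avs: "av L" "av R" and le: "\<forall>x\<in>set L. \<forall>y\<in>set R. y \<le> x"
    using zs(3) un av_split_at_max[of L R n] by (auto simp: LR)
  have disj: "set L \<inter> set R = {}" using zs by (auto simp: LR)
  define r where "r = card (set R)"
  have R: "set R = {1..r}"
    unfolding r_def
  proof (rule down_closed_eq_atLeastAtMost)
    have "set R \<subseteq> {1..<n}" using un by blast
    then show "0 \<notin> set R" by auto
    fix x y assume xy: "x \<in> set R" "1 \<le> y" "y \<le> x"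
    show "y \<in> set R"
    proof (rule ccontr)
      assume y: "y \<notin> set R"
      have "x \<in> {1..<n}" using xy(1) un by blast
      then have "y \<in> set L \<union> set R" unfolding un using xy by simp
      then have "x \<le> y" using le xy(1) y by blast
      then show False using xy y by simp
    qed
  qed simp
  have "{1..r} \<subseteq> {1..<n}" using un R by blast
  then have rn: "r < n" using assms(1) by (cases "r = 0") (auto dest: subsetD[of _ _ r])
  have "set L = {1..<n} - {1..r}" using un disj R by blast
  also have "\<dots> = {r + 1..<n}" by auto
  finally have Ls: "set L = {r + 1..<n}" .
  \<comment> \<open>An entry of \<open>L\<close> lies strictly between \<open>r\<close> and
    \<open>n\<close>, so \<open>n\<close> and the head of \<open>R\<close> cannot be close.\<close>
  have Lr: "r + 1 < n" using Ls L by (metis atLeastLessThan_empty_iff set_empty)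
  define xs where "xs = map (\<lambda>x. x - r) (L @ [n])"
  have mxs: "map (\<lambda>x. x + r) xs = L @ [n]"
    using Ls rn by (auto simp: xs_def intro!: map_idI)
  have "ok False (L @ [n]) \<and> ok False R"
  proof -
    have "R \<noteq> [] \<Longrightarrow> \<not> close n (hd R)"
      using R Lr hd_in_set[of R] by (auto simp: close_def)
    then show ?thesis using zs(4) ok_append[of R "L @ [n]" False] by (auto simp: LR)
  qed
  moreover have "av (L @ [n])" using avs un by (subst av_snoc_max) auto
  ultimately have okav: "ok False xs" "av xs" "ok False R"
    using ok_map_add[of False r xs] av_map_add[of r xs] mxs by auto
  have "distinct xs" using zs(1) mxs by (metis LR append.assoc append_Cons append_Nil distinct_append distinct_map)
  moreover have "set xs = {1..n - r}"
  proof -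
    have "set xs = (\<lambda>x. x - r) ` {r + 1..n}"
      using Ls rn by (auto simp: xs_def)
    also have "{r + 1..n} = (\<lambda>x. x + r) ` {1..n - r}"
      using rn by (simp add: image_add_atLeastAtMost' add.commute)
    finally show ?thesis by (simp only: image_image add_diff_cancel_right' image_ident)
  qed
  ultimately have "xs \<in> max_last av (n - r)"
    using okav by (auto simp: max_last_def perm_lists_def xs_def)
  moreover have "R \<in> perm_lists av r"
    using okav avs R zs(1) by (auto simp: perm_lists_def LR)
  moreover have "zs = glue n (n - r, xs, R)"
    using rn by (simp add: glue_def mxs LR)
  ultimately show ?thesis
    using rn by (intro image_eqI[of _ _ "(n - r, xs, R)"]) auto
qed

text \<open>The unique occurrence of \<open>n\<close> marks the cut, and the length
  \<open>n - k\<close> of the part after it recovers the shift.\<close>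

lemma inj_on_glue:
  "inj_on (glue n) (SIGMA k:{..n}. max_last av k \<times> perm_lists av (n - k))"
proof (rule inj_onI)
  fix p p' let ?S = "SIGMA k:{..n}. max_last av k \<times> perm_lists av (n - k)"
  assume p: "p \<in> ?S" "p' \<in> ?S" and "glue n p = glue n p'"
  then obtain k xs ys k' xs' ys' where pp': "p = (k, xs, ys)" "p' = (k', xs', ys')"
    and k: "k \<le> n" "xs \<in> max_last av k" "ys \<in> perm_lists av (n - k)"
    and k': "k' \<le> n" "xs' \<in> max_last av k'" "ys' \<in> perm_lists av (n - k')"
    and eq: "glue n (k, xs, ys) = glue n (k', xs', ys')"
    by (cases p; cases p') auto
  obtain M where M: "xs = M @ [k]" "set M = {1..<k}"
    using max_lastE[OF k(2)] by metis
  obtain M' where M': "xs' = M' @ [k']" "set M' = {1..<k'}"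
    using max_lastE[OF k'(2)] by metis
  let ?f = "\<lambda>k xs. map (\<lambda>x. x + (n - k)) xs"
  have "?f k M @ n # ys = ?f k' M' @ n # ys'"
    using eq k k' by (simp add: glue_def M M')
  moreover have "n \<notin> set (?f k M)" "n \<notin> set (?f k' M')"
    using k k' M M' by auto
  moreover have "n \<notin> set ys"
  proof -
    \<comment> \<open>This makes the bound \<open>n - k\<close> on the entries of \<open>ys\<close>
      smaller than \<open>n\<close>.\<close>
    have "0 < k" by (rule max_lastE[OF k(2)]) simp
    then show ?thesis using k by (auto simp: perm_lists_def)
  qed
  ultimately have e: "?f k M = ?f k' M'" "ys = ys'"
    by (auto simp: append_Cons_eq_iff)
  then have "n - k = n - k'"
    using k k' length_perm_lists by metis
  then have "k = k'" using k k' by simp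
  moreover have "inj (\<lambda>x::nat. x + (n - k'))" by (simp add: inj_on_def)
  ultimately show "p = p'"
    using e M M' pp' by (metis map_injective)
qed

text \<open>Lists not starting with \<open>n\<close> correspond under \<open>glue\<close> to
  triples, and \<open>card_max_last\<close> replaces the count of trailing maxima by that of leading
  ones. Positivity of \<open>n\<close> excludes the empty list, which has no maximum to cut
  at.\<close>

lemma card_perm_lists_av:
  assumes "0 < n"
  shows "card (perm_lists av n) = card (max_first av n) +
    (\<Sum>k\<le>n. card (max_first av k) * card (perm_lists av (n - k)))"
proof -
  let ?S = "SIGMA k:{..n}. max_last av k \<times> perm_lists av (n - k)"
  have "finite (max_last av k)" for k by (simp add: max_last_def)
  then have "card ?S = (\<Sum>k\<le>n. card (max_last av k) * card (perm_lists av (n - k)))"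
    by (subst card_SigmaI) (auto simp: card_cartesian_product)
  also have "\<dots> = (\<Sum>k\<le>n. card (max_first av k) * card (perm_lists av (n - k)))"
    by (simp add: card_max_last av_Cons_max av_snoc_max del: av.simps)
  moreover have "perm_lists av n - max_first av n = glue n ` ?S"
    using in_glue_image[OF assms] glue_in by fast
  then have "card (perm_lists av n - max_first av n) = card ?S"
    by (simp add: card_image inj_on_glue)
  moreover have "max_first av n \<subseteq> perm_lists av n" by (auto simp: max_first_def)
  ultimately show ?thesis
    by (simp add: card_Diff_subset) (metis card_mono finite_perm_lists le_add_diff_inverse)
qed

section \<open>From functions to lists\<close>

lemma bij_betw_permutes_lists:
  "bij_betw (\<lambda>\<sigma>. map \<sigma> [1..<Suc n]) {\<sigma>. \<sigma> permutes {1..n}} {xs. distinct xs \<and> set xs = {1..n}}"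
proof (rule bij_betwI')
  fix \<sigma> \<tau> assume "\<sigma> \<in> {\<sigma>. \<sigma> permutes {1..n}}" "\<tau> \<in> {\<sigma>. \<sigma> permutes {1..n}}"
  then have *: "\<sigma> i = \<tau> i" if "i \<notin> {1..n}" for i
    using that by (auto simp: permutes_def)
  show "map \<sigma> [1..<Suc n] = map \<tau> [1..<Suc n] \<longleftrightarrow> \<sigma> = \<tau>"
  proof
    assume "map \<sigma> [1..<Suc n] = map \<tau> [1..<Suc n]"
    then have "\<sigma> i = \<tau> i" if "i \<in> {1..n}" for i
      using that by (auto simp del: upt_Suc)
    then show "\<sigma> = \<tau>" using * by blast
  qed simp
next
  fix \<sigma> assume "\<sigma> \<in> {\<sigma>. \<sigma> permutes {1..n}}"
  then have p: "\<sigma> permutes {1..n}" by simp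
  have "set (map \<sigma> [1..<Suc n]) = {1..n}"
    using permutes_image[OF p] by (simp add: atLeastLessThanSuc_atLeastAtMost del: upt_Suc)
  moreover have "distinct (map \<sigma> [1..<Suc n])"
    using permutes_inj_on[OF p] by (simp add: distinct_map del: upt_Suc)
  ultimately show "map \<sigma> [1..<Suc n] \<in> {xs. distinct xs \<and> set xs = {1..n}}" by simp
next
  fix xs :: "nat list" assume "xs \<in> {xs. distinct xs \<and> set xs = {1..n}}"
  then have xs: "distinct xs" "set xs = {1..n}" by auto
  then have len: "length xs = n" by (metis card_atLeastAtMost diff_Suc_1 distinct_card)
  \<comment> \<open>Positions start at 1 but list indices at 0; \<open>permutes\<close> demands the
    identity outside \<open>{1..n}\<close>.\<close>
  define \<sigma> where "\<sigma> i = (if i \<in> {1..n} then xs ! (i - 1) else i)" for i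
  have eq: "map \<sigma> [1..<Suc n] = xs"
    by (rule nth_equalityI) (auto simp: len \<sigma>_def nth_append simp del: upt_Suc)
  have "\<sigma> ` {1..n} = {1..n}"
    using xs(2) unfolding eq[symmetric] by (simp add: atLeastLessThanSuc_atLeastAtMost del: upt_Suc)
  then have "bij_betw \<sigma> {1..n} {1..n}"
    by (simp add: bij_betw_def finite_surj_inj)
  then have "\<sigma> permutes {1..n}"
    by (rule bij_imp_permutes) (simp only: \<sigma>_def if_False)
  then show "\<exists>\<sigma>\<in>{\<sigma>. \<sigma> permutes {1..n}}. xs = map \<sigma> [1..<Suc n]"
    using eq by auto
qed

lemma avoids_132_iff_av: "avoids_132 n \<sigma> \<longleftrightarrow> av (map \<sigma> [1..<Suc n])"
proof
  assume "avoids_132 n \<sigma>"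
  then have "False" if "1 \<le> i" "i < j" "j < k" "k \<le> n" "\<sigma> i < \<sigma> k" "\<sigma> k < \<sigma> j" for i j k
    using that unfolding avoids_132_def by blast
  from this[of "Suc _" "Suc _" "Suc _"] show "av (map \<sigma> [1..<Suc n])"
    unfolding av_nth by (simp add: Suc_le_eq del: upt_Suc) blast
next
  assume av: "av (map \<sigma> [1..<Suc n])"
  show "avoids_132 n \<sigma>"
    unfolding avoids_132_def
  proof (intro notI, elim exE conjE)
    fix i j k assume *: "1 \<le> i" "i < j" "j < k" "k \<le> n" "\<sigma> i < \<sigma> k" "\<sigma> k < \<sigma> j"
    then obtain i' j' k' where "i = Suc i'" "j = Suc j'" "k = Suc k'"
      by (cases i; cases j; cases k) auto
    with av[unfolded av_nth, rule_format, of k' j' i'] * show False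
      by (simp del: upt_Suc)
  qed
qed

lemma ball_atLeast1_iff: "(\<forall>i\<in>{1..n}. P i) \<longleftrightarrow> (\<forall>i<n. P (Suc i))"
proof -
  have "(\<forall>i\<in>{1..n}. P i) \<longleftrightarrow> (\<forall>i\<in>Suc ` {..<n}. P i)"
    by (simp only: image_Suc_lessThan)
  then show ?thesis by (simp only: ball_simps) (simp only: Ball_def lessThan_iff)
qed

text \<open>Length 1 is excluded because there the definition accepts the single entry while
  \<open>ok False\<close> rejects it.\<close>

lemma every_entry_iff_ok:
  "n \<noteq> Suc 0 \<Longrightarrow> every_entry_has_close_neighbour n \<sigma> \<longleftrightarrow> ok False (map \<sigma> [1..<Suc n])"
  unfolding every_entry_has_close_neighbour_def ok_nth ball_atLeast1_iff
  by (auto simp: close_iff_abs simp del: upt_Suc)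

lemma a_seq_eq_card: "n \<noteq> Suc 0 \<Longrightarrow> a_seq n = card (perm_lists av n)"
proof (cases "n = 0")
  case False
  assume n: "n \<noteq> Suc 0"
  have "bij_betw (\<lambda>\<sigma>. map \<sigma> [1..<Suc n])
     {\<sigma> \<in> {\<sigma>. \<sigma> permutes {1..n}}. avoids_132 n \<sigma> \<and> every_entry_has_close_neighbour n \<sigma>}
     {xs \<in> {xs. distinct xs \<and> set xs = {1..n}}. av xs \<and> ok False xs}"
    by (intro bij_betw_Collect bij_betw_permutes_lists)
      (simp add: avoids_132_iff_av every_entry_iff_ok n del: upt_Suc)
  from bij_betw_same_card[OF this] False show ?thesis
    by (simp add: a_seq_def S132_def perm_lists_def)
qed (simp add: a_seq_def)

lemma b_seq_eq_card: "n \<noteq> Suc 0 \<Longrightarrow> b_seq n = card (max_first av n)"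
proof (cases "n = 0")
  case False
  assume n: "n \<noteq> Suc 0"
  have "map \<sigma> [1..<Suc n] \<noteq> [] \<and> hd (map \<sigma> [1..<Suc n]) = \<sigma> 1" for \<sigma> :: "nat \<Rightarrow> nat"
    using False by (simp add: hd_map del: upt_Suc)
  then have "bij_betw (\<lambda>\<sigma>. map \<sigma> [1..<Suc n])
     {\<sigma> \<in> {\<sigma>. \<sigma> permutes {1..n}}. avoids_132 n \<sigma> \<and> every_entry_has_close_neighbour n \<sigma> \<and> \<sigma> 1 = n}
     {xs \<in> {xs. distinct xs \<and> set xs = {1..n}}. av xs \<and> ok False xs \<and> xs \<noteq> [] \<and> hd xs = n}"
    by (intro bij_betw_Collect bij_betw_permutes_lists)
      (simp add: avoids_132_iff_av every_entry_iff_ok n del: upt_Suc)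
  from bij_betw_same_card[OF this] False show ?thesis
    by (simp add: b_seq_def S132_def perm_lists_def max_first_def)
qed (simp add: b_seq_def)

lemma S132_1: "S132 (Suc 0) = {id}"
  by (auto simp: S132_def avoids_132_def permutes_sing)

lemma a_seq_1: "a_seq (Suc 0) = 1"
  by (simp add: a_seq_def S132_1 every_entry_has_close_neighbour_def)

lemma b_seq_1: "b_seq (Suc 0) = 1"
proof -
  have "{\<sigma>. \<sigma> = id \<and> \<sigma> (Suc 0) = Suc 0} = {id}" by auto
  then show ?thesis by (simp add: b_seq_def S132_1 every_entry_has_close_neighbour_def)
qed

section \<open>Generating functions\<close>

definition A' :: "real fps" where
  "A' = Abs_fps (\<lambda>n. of_nat (card (perm_lists av n)))"

definition B' :: "real fps" where
  "B' = Abs_fps (\<lambda>n. of_nat (card (max_first av n)))"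

lemma A_gf_eq: "A_gf = A' + fps_X"
  by (rule fps_ext) (auto simp: A_gf_def A'_def fps_X_def a_seq_eq_card a_seq_1)

lemma B_gf_eq: "B_gf = B' + fps_X"
  by (rule fps_ext) (auto simp: B_gf_def B'_def fps_X_def b_seq_eq_card b_seq_1)

text \<open>The sum in \<open>card_perm_lists_av\<close> is a Cauchy product; the summand 1 is the
  empty list.\<close>

lemma A'_eq: "A' = 1 + B' + B' * A'"
proof (rule fps_ext)
  fix n
  show "A' $ n = (1 + B' + B' * A') $ n"
  proof (cases "n = 0")
    case False
    then show ?thesis
      using card_perm_lists_av[of n]
      by (simp add: A'_def B'_def fps_mult_nth atMost_atLeast0)
  qed (simp add: A'_def B'_def)
qed

lemma B'_eq: "(1 - fps_X + fps_X ^ 2) * B' = fps_X ^ 2 * A'"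
proof (rule fps_ext)
  fix n
  have e: "(1 - fps_X + fps_X ^ 2) * B' = B' - fps_X * B' + fps_X ^ 2 * B'"
    by (simp add: algebra_simps)
  consider "n = 0" | "n = Suc 0" | m where "n = Suc (Suc m)" by (metis not0_implies_Suc)
  then show "((1 - fps_X + fps_X ^ 2) * B') $ n = (fps_X ^ 2 * A') $ n"
  proof cases
    case 3
    have "real (card (max_first av n)) + card (max_first av m) =
        card (max_first av (Suc m)) + card (perm_lists av m)"
      using card_max_first_rec[of m] 3 by (metis of_nat_add)
    then show ?thesis unfolding e by (simp add: fps_X_power_mult_nth A'_def B'_def 3)
  qed (unfold e, simp_all add: fps_X_power_mult_nth B'_def)
qed

text \<open>Eliminating \<open>B'\<close> leaves \<open>fps_X ^ 2 * A' ^ 2 - (1 - fps_X) * A' + (1 -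
  fps_X + fps_X ^ 2) = 0\<close>, whose discriminant is \<open>discr\<close>. Completing the square
  gives the claim; constant term 1 selects the branch.\<close>

lemma fps_sqrt_discr: "fps_sqrt discr = 1 - fps_X - 2 * fps_X ^ 2 * A'"
proof (rule fps_sqrt_unique[symmetric])
  \<comment> \<open>Multiplying \<open>A'_eq\<close> by \<open>1 - fps_X + fps_X ^ 2\<close> makes
    \<open>B'_eq\<close> applicable; the factor \<open>fps_X ^ 2\<close> matches the expanded
    square.\<close>
  have "fps_X ^ 2 * A' * (1 - fps_X + fps_X ^ 2) =
     fps_X ^ 2 * ((1 - fps_X + fps_X ^ 2) + (1 - fps_X + fps_X ^ 2) * B' + (1 - fps_X + fps_X ^ 2) * B' * A')"
    by (subst A'_eq) (simp add: algebra_simps)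
  then have "fps_X ^ 2 * (A' * (1 - fps_X + fps_X ^ 2)) =
     fps_X ^ 2 * ((1 - fps_X + fps_X ^ 2) + fps_X ^ 2 * A' + fps_X ^ 2 * A' * A')"
    unfolding B'_eq by (simp only: mult.assoc)
  then show "(1 - fps_X - 2 * fps_X ^ 2 * A') ^ 2 = discr"
    unfolding discr_def by algebra
qed simp

text \<open>Reduces a quotient of Laurent series to a product identity of power series.\<close>

lemma fls_divide_eqI:
  fixes f g h :: "real fps"
  assumes "f = g * h" "g \<noteq> 0"
  shows "fps_to_fls h = fps_to_fls f / fps_to_fls g"
  using assms by (simp add: fls_times_fps_to_fls)

theorem theorem7:
  shows "fps_to_fls A_gf =
           fps_to_fls (1 - fps_X + 2 * fps_X ^ 3 - fps_sqrt discr) /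
           fps_to_fls (2 * fps_X ^ 2) \<and>
         fps_to_fls B_gf =
           fps_to_fls (1 + fps_X - 2 * fps_X ^ 2 + 2 * fps_X ^ 3 - fps_sqrt discr) /
           fps_to_fls (2 * (1 - fps_X + fps_X ^ 2)) \<and>
         map a_seq [0..<11] = [1, 1, 2, 2, 6, 10, 26, 54, 134, 306, 754] \<and>
         map b_seq [0..<11] = [0, 1, 1, 1, 2, 3, 7, 14, 33, 73, 174]"
proof (intro conjI)
  show "fps_to_fls A_gf =
      fps_to_fls (1 - fps_X + 2 * fps_X ^ 3 - fps_sqrt discr) / fps_to_fls (2 * fps_X ^ 2)"
    by (rule fls_divide_eqI)
      (simp_all add: A_gf_eq fps_sqrt_discr algebra_simps power2_eq_square power3_eq_cube)
  have "(1 - fps_X + fps_X ^ 2 :: real fps) $ 0 \<noteq> 0" by simp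
  then have "2 * (1 - fps_X + fps_X ^ 2 :: real fps) \<noteq> 0"
    by (metis fps_zero_nth mult_eq_0_iff zero_neq_numeral)
  \<comment> \<open>The square root contributes \<open>2 * fps_X ^ 2 * A'\<close>, which
    \<open>B'_eq\<close> turns into the \<open>B'\<close> part; the remaining polynomial is the
    share of \<open>fps_X\<close> in \<open>B_gf\<close>.\<close>
  moreover have "1 + fps_X - 2 * fps_X ^ 2 + 2 * fps_X ^ 3 - fps_sqrt discr =
      2 * (1 - fps_X + fps_X ^ 2) * B_gf"
    using B'_eq unfolding B_gf_eq fps_sqrt_discr by algebra
  ultimately show "fps_to_fls B_gf =
      fps_to_fls (1 + fps_X - 2 * fps_X ^ 2 + 2 * fps_X ^ 3 - fps_sqrt discr) /
      fps_to_fls (2 * (1 - fps_X + fps_X ^ 2))"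
    by (intro fls_divide_eqI)
  let ?a = "\<lambda>n. card (perm_lists av n)" and ?b = "\<lambda>n. card (max_first av n)"
  \<comment> \<open>The subtraction is exact, by the additive form of the recursion.\<close>
  have b: "?b (Suc (Suc n)) = ?b (Suc n) + ?a n - ?b n" for n
    using card_max_first_rec[of n] by simp
  \<comment> \<open>On the right, \<open>?a (Suc n)\<close> occurs only with the factor
    \<open>?b 0 = 0\<close>, so the values can be computed in turn, each \<open>?b\<close> before
    the \<open>?a\<close> of the same index.\<close>
  have a: "?a (Suc n) = ?b (Suc n) + (\<Sum>k\<le>Suc n. ?b k * ?a (Suc n - k))" for n
    by (rule card_perm_lists_av) simp
  have b2: "?b 2 = 1" using b[of 0] by (simp add: numeral_eq_Suc)
  have a2: "?a 2 = 2" using a[of 1] b2 by (simp add: numeral_eq_Suc)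
  have b3: "?b 3 = 1" using b[of 1] b2 by (simp add: numeral_eq_Suc)
  have a3: "?a 3 = 2" using a[of 2] b2 b3 a2 by (simp add: numeral_eq_Suc)
  have b4: "?b 4 = 2" using b[of 2] b3 a2 b2 by (simp add: numeral_eq_Suc)
  have a4: "?a 4 = 6" using a[of 3] b2 b3 b4 a2 a3 by (simp add: numeral_eq_Suc)
  have b5: "?b 5 = 3" using b[of 3] b4 a3 b3 by (simp add: numeral_eq_Suc)
  have a5: "?a 5 = 10" using a[of 4] b2 b3 b4 b5 a2 a3 a4 by (simp add: numeral_eq_Suc)
  have b6: "?b 6 = 7" using b[of 4] b5 a4 b4 by (simp add: numeral_eq_Suc)
  have a6: "?a 6 = 26" using a[of 5] b2 b3 b4 b5 b6 a2 a3 a4 a5 by (simp add: numeral_eq_Suc)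
  have b7: "?b 7 = 14" using b[of 5] b6 a5 b5 by (simp add: numeral_eq_Suc)
  have a7: "?a 7 = 54" using a[of 6] b2 b3 b4 b5 b6 b7 a2 a3 a4 a5 a6 by (simp add: numeral_eq_Suc)
  have b8: "?b 8 = 33" using b[of 6] b7 a6 b6 by (simp add: numeral_eq_Suc)
  have a8: "?a 8 = 134" using a[of 7] b2 b3 b4 b5 b6 b7 b8 a2 a3 a4 a5 a6 a7 by (simp add: numeral_eq_Suc)
  have b9: "?b 9 = 73" using b[of 7] b8 a7 b7 by (simp add: numeral_eq_Suc)
  have a9: "?a 9 = 306" using a[of 8] b2 b3 b4 b5 b6 b7 b8 b9 a2 a3 a4 a5 a6 a7 a8 by (simp add: numeral_eq_Suc)
  have b10: "?b 10 = 174" using b[of 8] b9 a8 b8 by (simp add: numeral_eq_Suc)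
  have a10: "?a 10 = 754" using a[of 9] b2 b3 b4 b5 b6 b7 b8 b9 b10 a2 a3 a4 a5 a6 a7 a8 a9 by (simp add: numeral_eq_Suc)
  have upt: "[0..<11] = [0, 1, 2, 3, 4, 5, 6, 7, 8, 9, 10]"
    by (simp add: upt_rec numeral_eq_Suc)
  show "map a_seq [0..<11] = [1, 1, 2, 2, 6, 10, 26, 54, 134, 306, 754]"
    using a2 a3 a4 a5 a6 a7 a8 a9 a10 by (simp add: upt a_seq_eq_card a_seq_1)
  show "map b_seq [0..<11] = [0, 1, 1, 1, 2, 3, 7, 14, 33, 73, 174]"
    using b2 b3 b4 b5 b6 b7 b8 b9 b10 by (simp add: upt b_seq_eq_card b_seq_1)
qed

end
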